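(* Let $d\geq 2$, let $\Omega\subset\mathbb{R}^d$ be a bounded domain (nonempty connected open set), and let $\varepsilon>0$. Let $\phi:[0,+\infty)\to\mathbb{R}$ be a radial function such that: (i) $\phi\in C^2([0,+\infty))$, $\phi$ is real analytic in $(0,+\infty)$, and $\lim_{r\to+\infty}\phi(r)=0$; (ii) the function $\ell(r)=\phi''(r)+\phi'(r)/r$, $r>0$, is continuous at $r=0$ (that is, it extends continuously to $r=0$, with value denoted $\ell(0)$), $\ell(0)\neq 0$, and $\lim_{r\to+\infty}\ell(r)=0$; (iii) setting $\phi_\varepsilon(r)=\phi(\varepsilon r)$, for every $m\geq 1$ and every set of $m$ distinct points $\{Q_1,\dots,Q_m\}\subset\mathbb{R}^d$ the interpolation matrix $V_m=\big(\phi_\varepsilon(\|Q_h-Q_k\|_2)\big)_{1\leq h,k\leq m}$ is nonsingular. Let $m\geq 1$, let $\{Q_1,\dots,Q_m\}$ be any fixed set of $m$ distinct points on $\partial\Omega$, and let $P_1,P_2,\dots$ be a sequence of independent and identically distributed random points in $\Omega$, distributed with respect to any probability density $\sigma\in L^1_+(\Omega)$. For $n\geq 0$ let $K_n$ be the $(n+m)\times(n+m)$ unsymmetric Kansa collocation matrix generated by $\phi_\varepsilon$ with internal collocation points $P_1,\dots,P_n$ and boundary collocation points $Q_1,\dots,Q_m$, for the Poisson equation with Dirichlet boundary conditions in $\Omega$. Then for every $m\geq 1$ and every $n\geq 0$ the matrix $K_n$ is almost surely nonsingular.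
   Context: The problem being discretized is $\Delta u(P)=f(P)$ for $P\in\Omega$, $u(P)=g(P)$ for $P\in\partial\Omega$, where $\Delta=\partial^2/\partial x_1^2+\dots+\partial^2/\partial x_d^2$ is the Laplacian in $\mathbb{R}^d$. Given points $P_1,\dots,P_n\in\Omega$ and $Q_1,\dots,Q_m\in\partial\Omega$, define functions on $\mathbb{R}^d$ by $$\phi_j(P)=\phi_\varepsilon(\|P-P_j\|_2),\quad 1\leq j\leq n,\qquad \psi_k(P)=\phi_\varepsilon(\|P-Q_k\|_2),\quad 1\leq k\leq m .$$ The unsymmetric Kansa method seeks $u_N=\sum_{j=1}^n c_j\phi_j+\sum_{k=1}^m d_k\psi_k$, $N=n+m$, such that $\Delta u_N(P_i)=f(P_i)$ for $1\leq i\leq n$ and $u_N(Q_h)=g(Q_h)$ for $1\leq h\leq m$. The matrix of this linear system is the Kansa collocation matrix $$K_n=\begin{pmatrix}(\Delta\phi_j(P_i)) & (\Delta\psi_k(P_i))\\ (\phi_j(Q_h)) & (\psi_k(Q_h))\end{pmatrix},\qquad 1\leq i,j\leq n,\ 1\leq h,k\leq m,$$ where $i$ and $h$ are row indices and $j$ and $k$ are column indices. For $n=0$, $K_0=(\psi_k(Q_h))_{1\leq h,k\leq m}=V_m$. $L^1_+(\Omega)$ denotes the nonnegative Lebesgue integrable functions on $\Omega$; a probability density $\sigma$ has integral $1$ over $\Omega$, and the law of each $P_i$ is $\sigma(x)\,dx$. "Almost surely" refers to the joint law of the random points $P_1,P_2,\dots$. *)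

theory Defs
  imports "HOL-Probability.Probability" "Jordan_Normal_Form.Matrix"
begin

definition real_analytic_on :: "(real \<Rightarrow> real) \<Rightarrow> real set \<Rightarrow> bool" where
  "real_analytic_on f S \<longleftrightarrow> (\<forall>x\<in>S. \<exists>F. (\<lambda>h. f (x + h)) has_fps_expansion F)"

(* Derivatives are taken within S, so at an endpoint of S they are one-sided
   and the values of f outside S are irrelevant. *)
definition C2_on :: "(real \<Rightarrow> real) \<Rightarrow> real set \<Rightarrow> bool" where
  "C2_on f S \<longleftrightarrow> (\<exists>f' f''.
     (\<forall>x\<in>S. (f has_real_derivative f' x) (at x within S)) \<and>
     (\<forall>x\<in>S. (f' has_real_derivative f'' x) (at x within S)) \<and>
     continuous_on S f'')"

(* Meaningful for r > 0 only; the value at 0 is described by a limit at_right 0. *)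
definition ell :: "(real \<Rightarrow> real) \<Rightarrow> real \<Rightarrow> real" where
  "ell \<phi> r = deriv (deriv \<phi>) r + deriv \<phi> r / r"

definition partial_deriv :: "'d::finite \<Rightarrow> (real ^ 'd \<Rightarrow> real) \<Rightarrow> real ^ 'd \<Rightarrow> real" where
  "partial_deriv i u x = deriv (\<lambda>t. u (x + t *\<^sub>R axis i 1)) 0"

definition laplacian :: "(real ^ 'd::finite \<Rightarrow> real) \<Rightarrow> real ^ 'd \<Rightarrow> real" where
  "laplacian u x = (\<Sum>i\<in>UNIV. partial_deriv i (partial_deriv i u) x)"

definition scaled :: "real \<Rightarrow> (real \<Rightarrow> real) \<Rightarrow> real \<Rightarrow> real" where
  "scaled \<epsilon> \<phi> r = \<phi> (\<epsilon> * r)"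

definition radial_at :: "(real \<Rightarrow> real) \<Rightarrow> real ^ 'd::finite \<Rightarrow> real ^ 'd \<Rightarrow> real" where
  "radial_at \<phi> C x = \<phi> (norm (x - C))"

(* Points are indexed from 0: Q 0, ..., Q (m - 1). *)
definition interp_matrix :: "(real \<Rightarrow> real) \<Rightarrow> nat \<Rightarrow> (nat \<Rightarrow> real ^ 'd::finite) \<Rightarrow> real mat" where
  "interp_matrix \<phi> m Q = mat m m (\<lambda>(h, k). \<phi> (norm (Q h - Q k)))"

definition kansa_matrix ::
  "(real \<Rightarrow> real) \<Rightarrow> nat \<Rightarrow> nat \<Rightarrow> (nat \<Rightarrow> real ^ 'd::finite) \<Rightarrow> (nat \<Rightarrow> real ^ 'd) \<Rightarrow> real mat" where
  "kansa_matrix \<phi> n m P Q =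
     four_block_mat
       (mat n n (\<lambda>(i, j). laplacian (radial_at \<phi> (P j)) (P i)))
       (mat n m (\<lambda>(i, k). laplacian (radial_at \<phi> (Q k)) (P i)))
       (mat m n (\<lambda>(h, j). radial_at \<phi> (P j) (Q h)))
       (mat m m (\<lambda>(h, k). radial_at \<phi> (Q k) (Q h)))"

definition prob_density_on :: "(real ^ 'd::finite) set \<Rightarrow> (real ^ 'd \<Rightarrow> real) \<Rightarrow> bool" where
  "prob_density_on \<Omega> \<sigma> \<longleftrightarrow>
     set_integrable lebesgue \<Omega> \<sigma> \<and> (\<forall>x\<in>\<Omega>. 0 \<le> \<sigma> x) \<and> (LINT x:\<Omega>|lebesgue. \<sigma> x) = 1"

(* The law of X is \<sigma>(x) dx on \<Omega>. The library's distributed does not fit directly: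
   X is a Borel random vector, whereas \<sigma> is only assumed Lebesgue measurable. *)
definition has_density_on ::
  "'w measure \<Rightarrow> ('w \<Rightarrow> real ^ 'd::finite) \<Rightarrow> (real ^ 'd) set \<Rightarrow> (real ^ 'd \<Rightarrow> real) \<Rightarrow> bool" where
  "has_density_on M X \<Omega> \<sigma> \<longleftrightarrow>
     X \<in> borel_measurable M \<and>
     (\<forall>A\<in>sets borel. emeasure M (X -` A \<inter> space M) = (\<integral>\<^sup>+x\<in>A \<inter> \<Omega>. ennreal (\<sigma> x) \<partial>lebesgue))"

end

theory Submission
  imports Defs "HOL-Complex_Analysis.Complex_Analysis" "HOL-Real_Asymp.Real_Asymp"
    "Jordan_Normal_Form.Determinant"
begin

text \<open>
  The idea is to let one collocation point run to infinity. Every entry of the Kansa matrix depends only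
  on the difference of two nodes: rows of interior points use the kernel \<open>\<kappa>(v)\<close>, the Laplacian of the
  radial function at offset \<open>v\<close> from its centre, and rows of boundary points use the radial function
  \<open>\<beta>(v)\<close> itself. Both kernels vanish at infinity, while \<open>\<kappa>(0)\<close> is a nonzero multiple of \<open>\<phi>''(0)\<close>. If the
  last interior point \<open>P\<^sub>n\<close> moves off to infinity, its row and its column therefore tend to zero except for
  the diagonal entry \<open>\<kappa>(0)\<close>, so the determinant of the matrix with \<open>n + 1\<close> interior points tends to \<open>\<kappa>(0)\<close>
  times the determinant with \<open>n\<close> of them (\<open>collocation_det_tendsto\<close>). If the latter is nonzero, the former
  is not identically zero on any line along which \<open>P\<^sub>n\<close> moves.

  Along a line that misses all other nodes the determinant is moreover a real analytic function of one real
  variable: \<open>\<phi>\<close> is analytic away from the origin, and so is the norm. Hence its zeros on the line are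
  countable. As the dimension is at least two, almost every line parallel to a fixed axis misses the finitely
  many other nodes, and Tonelli's theorem shows that the bad positions of \<open>P\<^sub>n\<close> form a Lebesgue null set
  (\<open>singular_positions_null\<close>). Restricting to lines makes the theory of zero sets of analytic functions
  of several variables superfluous.

  Since the law of each point is absolutely continuous and the points are independent, an induction on \<open>n\<close>
  over the product of the laws gives the theorem (\<open>AE_product_collocation_det_nonzero\<close>). It starts at
  \<open>n = 0\<close>, where the matrix is the nonsingular interpolation matrix of the \<open>Q\<^sub>k\<close>.

  Two points about the kernel need care. In dimension \<open>d\<close> the Laplacian of a radial function is
  \<open>\<phi>'' + (d - 1) \<phi>'/r\<close>, while the hypotheses control only \<open>\<ell> = \<phi>'' + \<phi>'/r\<close>. At zero, continuity of \<open>\<ell>\<close>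
  forces \<open>\<phi>'(0) = 0\<close> and \<open>\<ell>(0) = 2 \<phi>''(0)\<close>. At infinity, \<open>(r \<phi>')' = r \<ell>\<close> and l'Hopital's rule give
  \<open>\<phi>'/r \<rightarrow> 0\<close>, so both summands decay separately.
\<close>

section \<open>Real functions with local holomorphic extensions\<close>

text \<open>
  Real analyticity at a point, expressed through a holomorphic extension rather than a power series.
  In this form composition with a square root, and the isolation of zeros, are inherited from complex
  analysis.
\<close>

definition extends_holomorphically_at :: "(real \<Rightarrow> real) \<Rightarrow> real \<Rightarrow> bool" where
  "extends_holomorphically_at f x \<longleftrightarrow>
     (\<exists>g. g analytic_on {of_real x} \<and> (\<forall>\<^sub>F t in nhds x. complex_of_real (f t) = g (of_real t)))"

lemma extends_holomorphically_atI:
  assumes "g analytic_on {of_real x}" "\<forall>\<^sub>F t in nhds x. complex_of_real (f t) = g (of_real t)"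
  shows "extends_holomorphically_at f x"
  using assms unfolding extends_holomorphically_at_def by blast

lemma extends_holomorphically_at_const: "extends_holomorphically_at (\<lambda>_. c) x"
  by (rule extends_holomorphically_atI[where g = "\<lambda>_. of_real c"]) auto

lemma extends_holomorphically_at_add:
  assumes "extends_holomorphically_at f x" "extends_holomorphically_at g x"
  shows "extends_holomorphically_at (\<lambda>t. f t + g t) x"
proof -
  from assms obtain F G where "F analytic_on {of_real x}" "G analytic_on {of_real x}"
    and ev: "\<forall>\<^sub>F t in nhds x. complex_of_real (f t) = F (of_real t)"
      "\<forall>\<^sub>F t in nhds x. complex_of_real (g t) = G (of_real t)"
    unfolding extends_holomorphically_at_def by blast
  then have "(\<lambda>z. F z + G z) analytic_on {of_real x}" by (intro analytic_intros)
  moreover from ev have "\<forall>\<^sub>F t in nhds x. complex_of_real (f t + g t) = F (of_real t) + G (of_real t)"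
    by eventually_elim simp
  ultimately show ?thesis by (rule extends_holomorphically_atI)
qed

lemma extends_holomorphically_at_mult:
  assumes "extends_holomorphically_at f x" "extends_holomorphically_at g x"
  shows "extends_holomorphically_at (\<lambda>t. f t * g t) x"
proof -
  from assms obtain F G where "F analytic_on {of_real x}" "G analytic_on {of_real x}"
    and ev: "\<forall>\<^sub>F t in nhds x. complex_of_real (f t) = F (of_real t)"
      "\<forall>\<^sub>F t in nhds x. complex_of_real (g t) = G (of_real t)"
    unfolding extends_holomorphically_at_def by blast
  then have "(\<lambda>z. F z * G z) analytic_on {of_real x}" by (intro analytic_intros)
  moreover from ev have "\<forall>\<^sub>F t in nhds x. complex_of_real (f t * g t) = F (of_real t) * G (of_real t)"
    by eventually_elim simp
  ultimately show ?thesis by (rule extends_holomorphically_atI)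
qed

lemma extends_holomorphically_at_cong:
  assumes "extends_holomorphically_at f x" and ev: "\<forall>\<^sub>F t in nhds x. g t = f t"
  shows "extends_holomorphically_at g x"
proof -
  obtain F where F: "F analytic_on {of_real x}" and evF: "\<forall>\<^sub>F t in nhds x. complex_of_real (f t) = F (of_real t)"
    using assms(1) unfolding extends_holomorphically_at_def by blast
  from ev evF have "\<forall>\<^sub>F t in nhds x. complex_of_real (g t) = F (of_real t)"
    by eventually_elim simp
  with F show ?thesis by (rule extends_holomorphically_atI)
qed

lemma extends_holomorphically_at_inverse:
  assumes "x \<noteq> 0"
  shows "extends_holomorphically_at inverse x"
  by (rule extends_holomorphically_atI[where g = inverse])
     (use assms in \<open>auto intro!: analytic_intros\<close>)

lemma extends_holomorphically_at_sum:
  assumes "\<And>i. i \<in> I \<Longrightarrow> extends_holomorphically_at (f i) x"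
  shows "extends_holomorphically_at (\<lambda>t. \<Sum>i\<in>I. f i t) x"
  using assms
  by (induction I rule: infinite_finite_induct)
     (auto intro!: extends_holomorphically_at_const extends_holomorphically_at_add)

lemma extends_holomorphically_at_prod:
  assumes "\<And>i. i \<in> I \<Longrightarrow> extends_holomorphically_at (f i) x"
  shows "extends_holomorphically_at (\<lambda>t. \<Prod>i\<in>I. f i t) x"
  using assms
  by (induction I rule: infinite_finite_induct)
     (auto intro!: extends_holomorphically_at_const extends_holomorphically_at_mult)

text \<open>
  The same coefficients, read as complex numbers, have the same radius of convergence, and the complex
  series continues the real one.
\<close>

lemma extends_holomorphically_at_if_fps_expansion:
  assumes "(\<lambda>h. f (x + h)) has_fps_expansion F"
  shows "extends_holomorphically_at f x"
proof -
  define G where "G = Abs_fps (\<lambda>n. complex_of_real (fps_nth F n))"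
  have R: "fps_conv_radius G = fps_conv_radius F"
    unfolding fps_conv_radius_def conv_radius_def G_def by simp
  have pos: "fps_conv_radius F > 0" and ev: "\<forall>\<^sub>F h in nhds 0. eval_fps F h = f (x + h)"
    using assms by (auto simp: has_fps_expansion_def)
  have eval: "eval_fps G (of_real h) = of_real (eval_fps F h)" if "ereal (norm h) < fps_conv_radius F" for h
  proof -
    have "(\<lambda>n. fps_nth F n * h ^ n) sums eval_fps F h"
      using that by (rule sums_eval_fps)
    then have "(\<lambda>n. complex_of_real (fps_nth F n * h ^ n)) sums of_real (eval_fps F h)"
      by (rule sums_of_real)
    then show ?thesis by (simp add: sums_iff eval_fps_def G_def)
  qed
  have an0: "eval_fps G analytic_on {0}"
    by (rule has_fps_expansion_imp_analytic_0[OF eval_fps_has_fps_expansion]) (simp add: R pos)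
  have an: "(\<lambda>z. eval_fps G (z - of_real x)) analytic_on {of_real x}"
  proof -
    have "(\<lambda>z. z - of_real x) analytic_on {complex_of_real x}" by (intro analytic_intros)
    from analytic_on_compose_gen[OF this an0] show ?thesis by (simp add: o_def)
  qed
  have "\<forall>\<^sub>F h in nhds (0::real). h \<in> eball 0 (fps_conv_radius F)"
    using pos by (intro eventually_nhds_in_open) (auto simp: zero_ereal_def)
  then have "\<forall>\<^sub>F h in nhds 0. complex_of_real (f (x + h)) = eval_fps G (of_real h)"
    using ev by eventually_elim (auto simp: eval)
  then have "\<forall>\<^sub>F t in filtermap (\<lambda>h. h - - x) (nhds 0).
      complex_of_real (f t) = eval_fps G (of_real t - of_real x)"
    by (simp add: eventually_filtermap add.commute)
  then have "\<forall>\<^sub>F t in nhds x. complex_of_real (f t) = eval_fps G (of_real t - of_real x)"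
    unfolding filtermap_nhds_shift by simp
  with an show ?thesis by (rule extends_holomorphically_atI)
qed

text \<open>
  The derivative is a parameter, so that the lemma applies to the derivatives of a profile on the half-line,
  which need not agree with \<open>deriv\<close> everywhere.
\<close>

lemma fps_expansion_derivative:
  fixes f f' :: "real \<Rightarrow> real"
  assumes F: "(\<lambda>h. f (x + h)) has_fps_expansion F"
    and f': "\<forall>\<^sub>F t in nhds x. (f has_real_derivative f' t) (at t)"
  shows "(\<lambda>h. f' (x + h)) has_fps_expansion fps_deriv F"
proof -
  have "filterlim (\<lambda>h. x + h) (nhds x) (nhds 0)"
    by (rule tendsto_eq_intros filterlim_ident | simp)+
  from eventually_compose_filterlim[OF f' this]
  have "\<forall>\<^sub>F h in nhds 0. deriv (\<lambda>h. f (x + h)) h = f' (x + h)"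
    by eventually_elim (auto intro!: DERIV_imp_deriv simp: DERIV_shift add.commute)
  with has_fps_expansion_deriv[OF F] show ?thesis
    by (subst (asm) has_fps_expansion_cong[OF _ refl])
qed

text \<open>
  On a line the squared norm is a real quadratic polynomial. It is positive where the line avoids the
  origin, so near such a parameter the principal square root of its complexification is holomorphic and
  extends the norm.
\<close>

lemma extends_holomorphically_at_radial_line:
  fixes u v :: "'a::real_inner"
  assumes k: "extends_holomorphically_at k (norm (v + t *\<^sub>R u))" and nz: "v + t *\<^sub>R u \<noteq> 0"
  shows "extends_holomorphically_at (\<lambda>s. k (norm (v + s *\<^sub>R u))) t"
proof -
  define q where "q z = of_real (inner v v) + 2 * of_real (inner u v) * z + of_real (inner u u) * z\<^sup>2" for z :: complex
  have q: "q (of_real s) = of_real ((norm (v + s *\<^sub>R u))\<^sup>2)" for s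
  proof -
    have "(norm (v + s *\<^sub>R u))\<^sup>2 = inner v v + 2 * inner u v * s + inner u u * s\<^sup>2"
      unfolding power2_norm_eq_inner by (simp add: inner_simps inner_commute power2_eq_square algebra_simps)
    then show ?thesis by (simp add: q_def)
  qed
  have r: "csqrt (q (of_real s)) = of_real (norm (v + s *\<^sub>R u))" for s
    unfolding q by (subst csqrt_of_real) auto
  obtain F where F: "F analytic_on {of_real (norm (v + t *\<^sub>R u))}"
    and ev: "\<forall>\<^sub>F r in nhds (norm (v + t *\<^sub>R u)). complex_of_real (k r) = F (of_real r)"
    using k unfolding extends_holomorphically_at_def by blast
  have "q (of_real t) \<notin> \<real>\<^sub>\<le>\<^sub>0"
    unfolding q complex_nonpos_Reals_iff using nz by (simp del: of_real_power)
  then have "(\<lambda>z. csqrt (q z)) analytic_on {of_real t}"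
    unfolding q_def[abs_def] by (intro analytic_intros) auto
  then have "(F \<circ> (\<lambda>z. csqrt (q z))) analytic_on {of_real t}"
    by (rule analytic_on_compose_gen[OF _ F]) (auto simp: r)
  moreover have "filterlim (\<lambda>s. norm (v + s *\<^sub>R u)) (nhds (norm (v + t *\<^sub>R u))) (nhds t)"
    by (intro tendsto_intros filterlim_ident)
  then have "\<forall>\<^sub>F s in nhds t. complex_of_real (k (norm (v + s *\<^sub>R u))) = F (of_real (norm (v + s *\<^sub>R u)))"
    using ev by (rule eventually_compose_filterlim[rotated])
  then have "\<forall>\<^sub>F s in nhds t. complex_of_real (k (norm (v + s *\<^sub>R u))) = (F \<circ> (\<lambda>z. csqrt (q z))) (of_real s)"
    by (simp add: r)
  ultimately show ?thesis by (rule extends_holomorphically_atI)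
qed

text \<open>
  The dichotomy for zeros of the holomorphic extension, pulled back along the real axis.
\<close>

lemma extends_holomorphically_at_zeros:
  assumes "extends_holomorphically_at f x"
  shows "(\<forall>\<^sub>F t in nhds x. f t = 0) \<or> (\<forall>\<^sub>F t in at x. f t \<noteq> 0)"
proof -
  obtain g where g: "g analytic_on {of_real x}" 
    and ev: "\<forall>\<^sub>F t in nhds x. complex_of_real (f t) = g (of_real t)"
    using assms unfolding extends_holomorphically_at_def by blast
  have ev': "\<forall>\<^sub>F t in at x. complex_of_real (f t) = g (of_real t)"
    using ev by (auto simp: eventually_nhds_conv_at)
  have lim: "filterlim complex_of_real (at (of_real x)) (at x)"
    by (intro filterlim_atI) (auto intro!: tendsto_intros simp: eventually_at_filter)
  consider "\<forall>\<^sub>F z in at (of_real x). g z \<noteq> 0" | "\<exists>\<^sub>F z in at (of_real x). g z = 0"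
    by (auto simp: frequently_def)
  then show ?thesis
  proof cases
    case 1
    from eventually_compose_filterlim[OF 1 lim] ev' have "\<forall>\<^sub>F t in at x. f t \<noteq> 0"
      by eventually_elim auto
    then show ?thesis ..
  next
    case 2
    have z: "\<forall>\<^sub>F z in at (of_real x). g z = 0"
      using g by (intro not_essential_frequently_0_imp_eventually_0 2
          isolated_singularity_at_analytic not_essential_analytic) 
    have "(g \<longlongrightarrow> 0) (at (of_real x))" using z by (rule tendsto_eventually)
    moreover have "(g \<longlongrightarrow> g (of_real x)) (at (of_real x))"
      using analytic_at_imp_isCont[OF g] by (simp add: isCont_def)
    ultimately have g0: "g (of_real x) = 0"
      using tendsto_unique[OF at_neq_bot] by blast
    from eventually_compose_filterlim[OF z lim] ev' have "\<forall>\<^sub>F t in at x. f t = 0"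
      by eventually_elim auto
    moreover have "f x = 0" using eventually_nhds_x_imp_x[OF ev] g0 by simp
    ultimately show ?thesis by (auto simp: eventually_nhds_conv_at)
  qed
qed

text \<open>
  The points near which \<open>f\<close> vanishes identically form a set that is open and closed, and that misses \<open>a\<close>.
  By connectedness of the line it is empty, so the zeros do not accumulate anywhere.
\<close>

lemma countable_zeros_if_analytic:
  assumes an: "\<And>x. extends_holomorphically_at f x" and nz: "f a \<noteq> 0"
  shows "countable {x. f x = 0}"
proof -
  define A where "A = {x. \<forall>\<^sub>F t in nhds x. f t = 0}"
  have "open A"
  proof (rule Topological_Spaces.openI)
    fix x assume "x \<in> A"
    then obtain T where "open T" "x \<in> T" "\<forall>t\<in>T. f t = 0"
      by (auto simp: A_def eventually_nhds)
    then have "T \<subseteq> A" by (auto simp: A_def eventually_nhds)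
    then show "\<exists>T. open T \<and> x \<in> T \<and> T \<subseteq> A" using \<open>open T\<close> \<open>x \<in> T\<close> by blast
  qed
  moreover have "open (- A)"
  proof (rule Topological_Spaces.openI)
    fix x assume "x \<in> - A"
    then have "\<forall>\<^sub>F t in at x. f t \<noteq> 0" using extends_holomorphically_at_zeros[OF an[of x]] by (simp add: A_def)
    then have "\<forall>\<^sub>F t in at x. t \<in> - A"
      by eventually_elim (auto simp: A_def dest: eventually_nhds_x_imp_x)
    then have "\<forall>\<^sub>F t in nhds x. t \<in> - A" using \<open>x \<in> - A\<close> by (simp add: eventually_nhds_conv_at)
    then show "\<exists>T. open T \<and> x \<in> T \<and> T \<subseteq> - A" by (auto simp: eventually_nhds)
  qed
  then have "closed A" by (simp add: closed_def)
  moreover have "a \<notin> A" using nz by (auto simp: A_def dest: eventually_nhds_x_imp_x)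
  ultimately have "A = {}" using clopen[of A] by auto
  then have "\<forall>\<^sub>F t in at x. f t \<noteq> 0" for x
    using extends_holomorphically_at_zeros[OF an[of x]] by (auto simp: A_def)
  then have "{x. f x = 0} sparse_in UNIV"
    unfolding sparse_in_def islimpt_iff_eventually by auto
  from sparse_imp_countable[OF _ this] show ?thesis by auto
qed

section \<open>Null sets detected along parallel lines\<close>

text \<open>
  Translating \<open>Z\<close> does not change its measure, so this measure is also its average over the translates of \<open>Z\<close>
  by \<open>- t u\<close> with \<open>t\<close> in the unit interval. Exchanging the integrals leaves the measures of the linear
  sections of \<open>Z\<close>, which are zero. This replaces a decomposition of the space as a product of \<open>u\<close> and its
  complement.
\<close>

lemma null_set_if_countable_along_lines:
  fixes Z :: "'a::euclidean_space set" and u :: 'a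
  assumes Z[measurable]: "Z \<in> sets borel"
    and lines: "AE y in lborel. countable {t. y + t *\<^sub>R u \<in> Z}"
  shows "Z \<in> null_sets lborel"
proof -
  have shift: "(\<integral>\<^sup>+y. indicator Z (y + t *\<^sub>R u) \<partial>lborel) = emeasure lborel Z" for t
  proof -
    have "emeasure lborel Z = (\<integral>\<^sup>+y. indicator Z y \<partial>distr lborel borel ((+) (t *\<^sub>R u)))"
      by (simp add: lborel_distr_plus)
    also have "\<dots> = (\<integral>\<^sup>+y. indicator Z (t *\<^sub>R u + y) \<partial>lborel)"
      by (subst nn_integral_distr) simp_all
    finally show ?thesis by (simp add: add.commute)
  qed
  have "emeasure lborel Z = (\<integral>\<^sup>+t. indicator {0..1::real} t * emeasure lborel Z \<partial>lborel)"
    by (simp add: nn_integral_multc)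
  also have "\<dots> = (\<integral>\<^sup>+t. (\<integral>\<^sup>+y. indicator {0..1::real} t * indicator Z (y + t *\<^sub>R u) \<partial>lborel) \<partial>lborel)"
    by (simp add: nn_integral_cmult shift)
  also have "\<dots> = (\<integral>\<^sup>+y. (\<integral>\<^sup>+t. indicator {0..1::real} t * indicator Z (y + t *\<^sub>R u) \<partial>lborel) \<partial>lborel)"
    by (rule lborel_pair.Fubini') measurable
  also have "\<dots> = (\<integral>\<^sup>+y. 0 \<partial>(lborel :: 'a measure))"
  proof (rule nn_integral_cong_AE, use lines in eventually_elim)
    case (elim y)
    have "AE t in lborel. t \<notin> {t. y + t *\<^sub>R u \<in> Z}"
      by (rule AE_not_in) (rule countable_imp_null_set_lborel[OF elim])
    then have "AE t in lborel. indicator {0..1::real} t * indicator Z (y + t *\<^sub>R u) = (0 :: ennreal)"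
      by eventually_elim simp
    then have "(\<integral>\<^sup>+t. indicator {0..1::real} t * indicator Z (y + t *\<^sub>R u) \<partial>lborel)
        = (\<integral>\<^sup>+t. 0 \<partial>(lborel :: real measure))" 
      by (rule nn_integral_cong_AE)
    then show ?case by simp
  qed
  finally show ?thesis using Z by (auto simp: null_sets_def)
qed

section \<open>The Laplacian of a radial function\<close>

lemma has_real_derivative_norm_line:
  fixes w e :: "'a::real_inner"
  assumes "w + t *\<^sub>R e \<noteq> 0"
  shows "((\<lambda>s. norm (w + s *\<^sub>R e)) has_real_derivative inner e (w + t *\<^sub>R e) / norm (w + t *\<^sub>R e)) (at t)"
proof -
  have "((\<lambda>s. w + s *\<^sub>R e) has_derivative (\<lambda>h. h *\<^sub>R e)) (at t)"
    by (auto intro!: derivative_eq_intros)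
  from has_derivative_compose[OF this has_derivative_norm[OF assms]] show ?thesis
    unfolding has_field_derivative_def
    by (rule has_derivative_eq_rhs)
       (auto simp: fun_eq_iff sgn_div_norm inner_commute divide_inverse)
qed

lemma at_within_Ici_pos:
  fixes r :: real
  assumes "r > 0"
  shows "at r within {0..} = at r"
  by (rule at_within_interior) (use assms in simp)

text \<open>
  The Laplacian in dimension \<open>d\<close> of \<open>x \<mapsto> f(|x|)\<close> as a function of the radius. At the centre the quotient
  \<open>f' r / r\<close> is replaced by its limit \<open>f'' 0\<close>.
\<close>

definition radial_laplacian :: "nat \<Rightarrow> (real \<Rightarrow> real) \<Rightarrow> (real \<Rightarrow> real) \<Rightarrow> real \<Rightarrow> real" where
  "radial_laplacian d f' f'' r =
     (if r = 0 then real d * f'' 0 else f'' r + real (d - 1) * (f' r / r))"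

text \<open>
  The profiles that define twice continuously differentiable radial functions. Derivatives are taken within
  the half-line because the values of \<open>f\<close> at negative arguments are arbitrary.
\<close>

locale radial_profile =
  fixes f f' f'' :: "real \<Rightarrow> real"
  assumes D1: "\<And>r. r \<ge> 0 \<Longrightarrow> (f has_real_derivative f' r) (at r within {0..})"
    and D2: "\<And>r. r \<ge> 0 \<Longrightarrow> (f' has_real_derivative f'' r) (at r within {0..})"
    and cont: "continuous_on {0..} f''"
    and zero: "f' 0 = 0"
begin

lemma deriv1_pos: "r > 0 \<Longrightarrow> (f has_real_derivative f' r) (at r)"
  using D1[of r] at_within_Ici_pos[of r] by simp

lemma deriv2_pos: "r > 0 \<Longrightarrow> (f' has_real_derivative f'' r) (at r)"
  using D2[of r] at_within_Ici_pos[of r] by simp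

text \<open>
  Along a coordinate axis through its centre the radial function is \<open>f\<close> extended evenly; without
  \<open>f' 0 = 0\<close> it would have a kink there.
\<close>

lemma even_extension_derivative_0: "((\<lambda>t. f \<bar>t\<bar>) has_real_derivative 0) (at 0)"
proof -
  have r: "((\<lambda>t. (f t - f 0) / t) \<longlongrightarrow> 0) (at_right 0)"
    using D1[of 0] by (simp add: zero has_field_derivative_iff at_within_Ici_at_right)
  have l: "((\<lambda>t. (f (- t) - f 0) / t) \<longlongrightarrow> 0) (at_left 0)"
    unfolding filterlim_at_left_to_right using tendsto_minus[OF r] by simp
  have pos: "\<forall>\<^sub>F t::real in at_right 0. 0 < t" and neg: "\<forall>\<^sub>F t::real in at_left 0. t < 0"
    by (simp_all add: eventually_at_filter)
  show ?thesis unfolding has_field_derivative_iff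
  proof (rule filterlim_split_at)
    show "((\<lambda>t. (f \<bar>t\<bar> - f \<bar>0\<bar>) / (t - 0)) \<longlongrightarrow> 0) (at_left 0)"
      by (rule Lim_transform_eventually[OF l], rule eventually_mono[OF neg]) simp
    show "((\<lambda>t. (f \<bar>t\<bar> - f \<bar>0\<bar>) / (t - 0)) \<longlongrightarrow> 0) (at_right 0)"
      by (rule Lim_transform_eventually[OF r], rule eventually_mono[OF pos]) simp
  qed
qed

text \<open>
  The first partial derivative along its own axis through the centre is \<open>f'\<close> extended oddly. At \<open>t = 0\<close>
  the quotient takes the value \<open>0\<close> by the convention for division by zero, which is the right one.
\<close>

lemma odd_extension_derivative_0: "((\<lambda>t. f' \<bar>t\<bar> * t / \<bar>t\<bar>) has_real_derivative f'' 0) (at 0)"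
proof -
  have r: "((\<lambda>t. f' t / t) \<longlongrightarrow> f'' 0) (at_right 0)"
    using D2[of 0] by (simp add: zero has_field_derivative_iff at_within_Ici_at_right)
  have l: "((\<lambda>t. f' (- t) / - t) \<longlongrightarrow> f'' 0) (at_left 0)"
    unfolding filterlim_at_left_to_right using r by simp
  have pos: "\<forall>\<^sub>F t::real in at_right 0. 0 < t" and neg: "\<forall>\<^sub>F t::real in at_left 0. t < 0"
    by (simp_all add: eventually_at_filter)
  show ?thesis unfolding has_field_derivative_iff
  proof (rule filterlim_split_at)
    show "((\<lambda>t. (f' \<bar>t\<bar> * t / \<bar>t\<bar> - f' \<bar>0\<bar> * 0 / \<bar>0\<bar>) / (t - 0)) \<longlongrightarrow> f'' 0) (at_left 0)"
      by (rule Lim_transform_eventually[OF l], rule eventually_mono[OF neg]) simp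
    show "((\<lambda>t. (f' \<bar>t\<bar> * t / \<bar>t\<bar> - f' \<bar>0\<bar> * 0 / \<bar>0\<bar>) / (t - 0)) \<longlongrightarrow> f'' 0) (at_right 0)"
      by (rule Lim_transform_eventually[OF r], rule eventually_mono[OF pos]) simp
  qed
qed

text \<open>
  The formula covers the centre as well, where the right-hand side is \<open>0\<close> by the convention for division by
  zero. It is therefore valid everywhere and can be differentiated again, at the centre too.
\<close>

lemma partial_deriv_radial:
  fixes x c :: "real ^ 'n::finite"
  shows "partial_deriv i (radial_at f c) x = f' (norm (x - c)) * (x - c) $ i / norm (x - c)"
proof (cases "x = c")
  case True
  have "(\<lambda>t. radial_at f c (x + t *\<^sub>R axis i 1)) = (\<lambda>t. f \<bar>t\<bar>)"
    by (auto simp: radial_at_def True)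
  then show ?thesis
    using DERIV_imp_deriv[OF even_extension_derivative_0] by (simp add: partial_deriv_def True)
next
  case False
  let ?e = "axis i 1 :: real ^ 'n"
  have n: "((\<lambda>s. norm (x - c + s *\<^sub>R ?e)) has_real_derivative
      inner ?e (x - c + 0 *\<^sub>R ?e) / norm (x - c + 0 *\<^sub>R ?e)) (at 0)"
    by (rule has_real_derivative_norm_line) (use False in simp)
  have "((\<lambda>s. f (norm (x - c + s *\<^sub>R ?e))) has_real_derivative
      f' (norm (x - c + 0 *\<^sub>R ?e)) * (inner ?e (x - c + 0 *\<^sub>R ?e) / norm (x - c + 0 *\<^sub>R ?e))) (at 0)"
    by (rule DERIV_chain2[OF deriv1_pos n]) (use False in simp)
  then have "deriv (\<lambda>s. f (norm (x - c + s *\<^sub>R ?e))) 0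
      = f' (norm (x - c + 0 *\<^sub>R ?e)) * (inner ?e (x - c + 0 *\<^sub>R ?e) / norm (x - c + 0 *\<^sub>R ?e))"
    by (rule DERIV_imp_deriv)
  moreover have "(\<lambda>t. radial_at f c (x + t *\<^sub>R axis i 1)) = (\<lambda>s. f (norm (x - c + s *\<^sub>R ?e)))"
    by (simp add: radial_at_def algebra_simps)
  ultimately show ?thesis
    by (simp add: partial_deriv_def inner_axis')
qed

lemma partial_deriv2_radial_center:
  "partial_deriv i (partial_deriv i (radial_at f c)) c = f'' 0"
proof -
  have "(\<lambda>t. partial_deriv i (radial_at f c) (c + t *\<^sub>R axis i 1)) = (\<lambda>t. f' \<bar>t\<bar> * t / \<bar>t\<bar>)"
    by (auto simp: partial_deriv_radial)
  then show ?thesis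
    using DERIV_imp_deriv[OF odd_extension_derivative_0]
    by (simp add: partial_deriv_def[of i "partial_deriv i (radial_at f c)"])
qed

lemma partial_deriv2_radial:
  fixes x c :: "real ^ 'n::finite"
  assumes "x \<noteq> c"
  defines "r \<equiv> norm (x - c)"
  shows "partial_deriv i (partial_deriv i (radial_at f c)) x =
     (f'' r - f' r / r) * (((x - c) $ i)\<^sup>2 / r\<^sup>2) + f' r / r"
proof -
  let ?e = "axis i 1 :: real ^ 'n"
  define w where "w = (x - c) $ i"
  have r: "r > 0" using assms by simp
  have n: "((\<lambda>s. norm (x - c + s *\<^sub>R ?e)) has_real_derivative w / r) (at 0)"
    using has_real_derivative_norm_line[of "x - c" 0 ?e] assms(1)
    by (simp add: r_def w_def inner_axis')
  have f: "((\<lambda>s. f' (norm (x - c + s *\<^sub>R ?e))) has_real_derivative f'' r * (w / r)) (at 0)"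
    using DERIV_chain2[OF deriv2_pos n] r by (simp add: r_def)
  have "((\<lambda>s. f' (norm (x - c + s *\<^sub>R ?e)) * (w + s) / norm (x - c + s *\<^sub>R ?e)) has_real_derivative
     ((f'' r * (w / r) * w + f' r) * r - f' r * w * (w / r)) / (r * r)) (at 0)"
    by (rule derivative_eq_intros f n refl | use r in \<open>simp add: r_def\<close>)+
  also have "((f'' r * (w / r) * w + f' r) * r - f' r * w * (w / r)) / (r * r) =
     (f'' r - f' r / r) * (w\<^sup>2 / r\<^sup>2) + f' r / r"
    using r by (simp add: field_simps power2_eq_square)
  also have "(\<lambda>s. f' (norm (x - c + s *\<^sub>R ?e)) * (w + s) / norm (x - c + s *\<^sub>R ?e)) =
     (\<lambda>t. partial_deriv i (radial_at f c) (x + t *\<^sub>R ?e))"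
    by (simp add: partial_deriv_radial w_def algebra_simps)
  finally show ?thesis
    unfolding partial_deriv_def[of i "partial_deriv i (radial_at f c)"] w_def
    by (rule DERIV_imp_deriv)
qed

lemma laplacian_radial:
  fixes x c :: "real ^ 'n::finite"
  shows "laplacian (radial_at f c) x = radial_laplacian CARD('n) f' f'' (norm (x - c))"
proof (cases "x = c")
  case True
  then show ?thesis by (simp add: laplacian_def partial_deriv2_radial_center radial_laplacian_def)
next
  case False
  define r where "r = norm (x - c)"
  have r: "r > 0" using False by (simp add: r_def)
  have "r\<^sup>2 = (\<Sum>i\<in>UNIV. ((x - c) $ i)\<^sup>2)"
    unfolding r_def power2_norm_eq_inner inner_vec_def by (simp add: power2_eq_square)
  then have s: "(\<Sum>i\<in>UNIV. ((x - c) $ i)\<^sup>2 / r\<^sup>2) = 1"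
    using r unfolding sum_divide_distrib[symmetric] by (metis divide_self zero_less_power less_irrefl)
  have "laplacian (radial_at f c) x =
    (\<Sum>i\<in>UNIV. (f'' r - f' r / r) * (((x - c) $ i)\<^sup>2 / r\<^sup>2) + f' r / r)"
    unfolding laplacian_def
    by (intro sum.cong refl partial_deriv2_radial[OF False, folded r_def])
  also have "\<dots> = (f'' r - f' r / r) + real CARD('n) * (f' r / r)"
    unfolding sum.distrib sum_distrib_left[symmetric] s by simp
  also have "\<dots> = radial_laplacian CARD('n) f' f'' r"
    using r by (simp add: radial_laplacian_def of_nat_diff algebra_simps)
  finally show ?thesis by (simp add: r_def)
qed

lemma radial_laplacian_continuous:
  fixes d :: nat
  assumes "d \<ge> 1"
  shows "continuous_on {0..} (radial_laplacian d f' f'')"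
  unfolding continuous_on_def
proof
  fix r :: real assume "r \<in> {0..}"
  have c2: "(f'' \<longlongrightarrow> f'' r) (at r within {0..})"
    using cont \<open>r \<in> {0..}\<close> by (simp add: continuous_on_def)
  show "(radial_laplacian d f' f'' \<longlongrightarrow> radial_laplacian d f' f'' r) (at r within {0..})"
  proof (cases "r = 0")
    case True
    have "((\<lambda>t. f' t / t) \<longlongrightarrow> f'' 0) (at 0 within {0..})"
      using D2[of 0] by (simp add: zero has_field_derivative_iff)
    with c2 have "((\<lambda>t. f'' t + real (d - 1) * (f' t / t)) \<longlongrightarrow> f'' 0 + real (d - 1) * f'' 0) (at 0 within {0..})"
      unfolding True by (intro tendsto_intros)
    also have "f'' 0 + real (d - 1) * f'' 0 = radial_laplacian d f' f'' 0"
      using assms by (simp add: radial_laplacian_def of_nat_diff algebra_simps)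
    finally show ?thesis unfolding True
      by (rule Lim_transform_eventually) (simp add: eventually_at_filter radial_laplacian_def)
  next
    case False
    then have r: "r > 0" using \<open>r \<in> {0..}\<close> by simp
    have c1: "(f' \<longlongrightarrow> f' r) (at r within {0..})"
      using DERIV_continuous[OF D2[of r]] r by (simp add: continuous_within)
    have "((\<lambda>t. f'' t + real (d - 1) * (f' t / t)) \<longlongrightarrow> f'' r + real (d - 1) * (f' r / r)) (at r within {0..})"
      by (intro tendsto_intros c1 c2 False)
    also have "f'' r + real (d - 1) * (f' r / r) = radial_laplacian d f' f'' r"
      using False by (simp add: radial_laplacian_def)
    finally show ?thesis
    proof (rule Lim_transform_eventually)
      have "\<forall>\<^sub>F t in at r. t \<noteq> 0" using False by (rule tendsto_imp_eventually_ne[OF tendsto_ident_at])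
      then show "\<forall>\<^sub>F t in at r within {0..}. f'' t + real (d - 1) * (f' t / t) = radial_laplacian d f' f'' t"
        unfolding at_within_Ici_pos[OF r] by eventually_elim (simp add: radial_laplacian_def)
    qed
  qed
qed

text \<open>
  Since \<open>(r f')' = r (f'' + f'/r)\<close>, l'Hopital's rule applied to \<open>r f'\<close> over \<open>r\<^sup>2 / 2\<close> gives \<open>f'/r \<rightarrow> 0\<close>. In this
  way the decay of the expression for dimension two yields that for every dimension.
\<close>

lemma radial_laplacian_tendsto_0:
  assumes ell: "((\<lambda>r. f'' r + f' r / r) \<longlongrightarrow> 0) at_top"
  shows "(radial_laplacian d f' f'' \<longlongrightarrow> 0) at_top"
proof -
  have pos: "\<forall>\<^sub>F r::real in at_top. 0 < r" by (rule eventually_gt_at_top)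
  have "((\<lambda>r. (r * f' r) / (r\<^sup>2 / 2)) \<longlongrightarrow> 0) at_top"
  proof (rule lhospital_at_top_at_top)
    show "filterlim (\<lambda>r::real. r\<^sup>2 / 2) at_top at_top"
      by real_asymp
    show "\<forall>\<^sub>F r::real in at_top. r \<noteq> 0" using pos by eventually_elim simp
    show "\<forall>\<^sub>F r in at_top. ((\<lambda>r. r * f' r) has_real_derivative r * (f'' r + f' r / r)) (at r)"
      using pos
    proof eventually_elim
      case (elim r)
      have "(f' has_real_derivative f'' r) (at r)"
        using D2[of r] elim by (simp add: at_within_Ici_pos)
      from DERIV_mult[OF DERIV_ident this] show ?case
        using elim by (simp add: algebra_simps)
    qed
    show "\<forall>\<^sub>F r::real in at_top. ((\<lambda>r. r\<^sup>2 / 2) has_real_derivative r) (at r)"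
      by (intro always_eventually allI) (auto intro!: derivative_eq_intros)
    show "((\<lambda>r. r * (f'' r + f' r / r) / r) \<longlongrightarrow> 0) at_top"
      by (rule Lim_transform_eventually[OF ell]) (rule eventually_mono[OF pos], simp)
  qed
  from tendsto_mult[OF tendsto_const this, of "1 / 2"]
  have quot: "((\<lambda>r. f' r / r) \<longlongrightarrow> 0) at_top"
    by (rule Lim_transform_eventually[OF tendsto_eq_rhs])
       (simp, rule eventually_mono[OF pos], simp add: power2_eq_square)
  have "((\<lambda>r. (f'' r + f' r / r) + (real (d - 1) - 1) * (f' r / r)) \<longlongrightarrow> 0 + (real (d - 1) - 1) * 0) at_top"
    by (intro tendsto_intros ell quot)
  then have "((\<lambda>r. (f'' r + f' r / r) + (real (d - 1) - 1) * (f' r / r)) \<longlongrightarrow> 0) at_top" by simp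
  then show ?thesis
    by (rule Lim_transform_eventually)
       (rule eventually_mono[OF pos], simp add: radial_laplacian_def left_diff_distrib del: times_divide_eq_right)
qed

lemma radial_laplacian_analytic:
  assumes an: "real_analytic_on f {0<..}" and r: "r > 0"
  shows "extends_holomorphically_at (radial_laplacian d f' f'') r"
proof -
  have ev: "\<forall>\<^sub>F t in nhds r. t \<in> {0<..}"
    using r by (intro eventually_nhds_in_open) auto
  obtain F where F: "(\<lambda>h. f (r + h)) has_fps_expansion F"
    using an r unfolding real_analytic_on_def by auto
  have F1: "(\<lambda>h. f' (r + h)) has_fps_expansion fps_deriv F"
  proof (rule fps_expansion_derivative[OF F])
    show "\<forall>\<^sub>F t in nhds r. (f has_real_derivative f' t) (at t)"
      using ev
    proof eventually_elim
      case (elim t) then show ?case using D1[of t] at_within_Ici_pos[of t] by simp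
    qed
  qed
  have F2: "(\<lambda>h. f'' (r + h)) has_fps_expansion fps_deriv (fps_deriv F)"
  proof (rule fps_expansion_derivative[OF F1])
    show "\<forall>\<^sub>F t in nhds r. (f' has_real_derivative f'' t) (at t)"
      using ev
    proof eventually_elim
      case (elim t) then show ?case using D2[of t] at_within_Ici_pos[of t] by simp
    qed
  qed
  have "extends_holomorphically_at (\<lambda>t. f'' t + real (d - 1) * (f' t * inverse t)) r"
    using r by (intro extends_holomorphically_at_add extends_holomorphically_at_mult extends_holomorphically_at_const
        extends_holomorphically_at_if_fps_expansion[OF F1] extends_holomorphically_at_if_fps_expansion[OF F2]
        extends_holomorphically_at_inverse) simp
  then show ?thesis
    by (rule extends_holomorphically_at_cong)
       (rule eventually_mono[OF ev], simp add: radial_laplacian_def divide_inverse)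
qed

end

text \<open>
  If \<open>\<ell> = f'' + f'/r\<close> has a limit at \<open>0\<close>, then so has \<open>f'/r\<close>. This forces \<open>f' 0 = 0\<close>, whence \<open>f'/r\<close> tends to
  \<open>f'' 0\<close> and the limit of \<open>\<ell>\<close> is \<open>2 f'' 0\<close>.
\<close>

lemma C2_radial_profile_if_ell_nonzero:
  assumes smooth: "C2_on f {0..}"
    and ell0: "\<exists>l. (ell f \<longlongrightarrow> l) (at_right 0) \<and> l \<noteq> 0"
  obtains f' f'' where "radial_profile f f' f''" "f'' 0 \<noteq> 0"
    "\<And>r. r > 0 \<Longrightarrow> ell f r = f'' r + f' r / r"
proof -
  obtain f' f'' where D1: "\<And>r. r \<ge> 0 \<Longrightarrow> (f has_real_derivative f' r) (at r within {0..})"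
    and D2: "\<And>r. r \<ge> 0 \<Longrightarrow> (f' has_real_derivative f'' r) (at r within {0..})"
    and cont: "continuous_on {0..} f''"
    using smooth unfolding C2_on_def by auto
  have d1: "deriv f r = f' r" if "r > 0" for r
    using D1[of r] that by (intro DERIV_imp_deriv) (simp add: at_within_Ici_pos)
  (* deriv is two-sided, so it agrees with the one-sided derivatives only in the interior. *)
  have ell: "ell f r = f'' r + f' r / r" if "r > 0" for r
  proof -
    have "\<forall>\<^sub>F t in nhds r. t \<in> {0<..}"
      using that by (intro eventually_nhds_in_open) auto
    then have "\<forall>\<^sub>F t in nhds r. deriv f t = f' t"
      by eventually_elim (simp add: d1)
    then have "deriv (deriv f) r = deriv f' r" by (rule deriv_cong_ev) simp
    also have "deriv f' r = f'' r"
      using D2[of r] that by (intro DERIV_imp_deriv) (simp add: at_within_Ici_pos)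
    finally show ?thesis using that by (simp add: ell_def d1)
  qed
  obtain l where l: "(ell f \<longlongrightarrow> l) (at_right 0)" "l \<noteq> 0" using ell0 by blast
  have pos: "\<forall>\<^sub>F r::real in at_right 0. 0 < r" by (simp add: eventually_at_filter)
  have lim2: "(f'' \<longlongrightarrow> f'' 0) (at_right 0)"
  proof -
    have "(f'' \<longlongrightarrow> f'' 0) (at 0 within {0..})" using cont by (simp add: continuous_on_def)
    then show ?thesis by (simp add: at_within_Ici_at_right)
  qed
  have "((\<lambda>r. ell f r - f'' r) \<longlongrightarrow> l - f'' 0) (at_right 0)"
    by (intro tendsto_diff l lim2)
  then have quot: "((\<lambda>r. f' r / r) \<longlongrightarrow> l - f'' 0) (at_right 0)"
    by (rule Lim_transform_eventually) (rule eventually_mono[OF pos], simp add: ell)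
  have id0: "((\<lambda>r::real. r) \<longlongrightarrow> 0) (at_right 0)" by (rule tendsto_ident_at)
  have "((\<lambda>r. r * (f' r / r)) \<longlongrightarrow> 0) (at_right 0)"
    using tendsto_mult[OF id0 quot] by simp
  then have "(f' \<longlongrightarrow> 0) (at_right 0)"
    by (rule Lim_transform_eventually) (rule eventually_mono[OF pos], simp)
  moreover have "(f' \<longlongrightarrow> f' 0) (at_right 0)"
    using DERIV_continuous[OF D2[of 0]] by (simp add: continuous_within at_within_Ici_at_right)
  ultimately have z: "f' 0 = 0"
    using tendsto_unique[OF trivial_limit_at_right_real] by blast
  have "((\<lambda>r. f' r / r) \<longlongrightarrow> f'' 0) (at_right 0)"
    using D2[of 0] by (simp add: z has_field_derivative_iff at_within_Ici_at_right)
  with quot have "l - f'' 0 = f'' 0"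
    using tendsto_unique[OF trivial_limit_at_right_real] by blast
  then have "f'' 0 \<noteq> 0" using l(2) by auto
  moreover have "radial_profile f f' f''" by unfold_locales (fact D1 D2 cont z)+
  ultimately show ?thesis using that ell by blast
qed

lemma has_real_derivative_dilate:
  fixes f :: "real \<Rightarrow> real"
  assumes "c \<ge> 0" and f: "(f has_real_derivative D) (at (c * r) within {0..})"
  shows "((\<lambda>r. f (c * r)) has_real_derivative c * D) (at r within {0..})"
proof -
  have "(f has_real_derivative D) (at (c * r) within (*) c ` {0..})"
    by (rule has_field_derivative_subset[OF f]) (use assms(1) in auto)
  moreover have "((*) c has_real_derivative c) (at r within {0..})"
    by (auto intro!: derivative_eq_intros)
  ultimately have "(f \<circ> (*) c has_real_derivative D * c) (at r within {0..})"
    by (rule DERIV_image_chain)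
  then show ?thesis by (simp add: o_def mult.commute)
qed

lemma radial_profile_scaled:
  assumes c: "c > 0" and f: "radial_profile f f' f''"
  shows "radial_profile (scaled c f) (\<lambda>r. c * f' (c * r)) (\<lambda>r. c * (c * f'' (c * r)))"
proof -
  interpret radial_profile f f' f'' by (rule f)
  show ?thesis
  proof
    fix r :: real assume r: "r \<ge> 0"
    show "(scaled c f has_real_derivative c * f' (c * r)) (at r within {0..})"
      unfolding scaled_def[abs_def] using c r by (intro has_real_derivative_dilate D1) auto
    show "((\<lambda>r. c * f' (c * r)) has_real_derivative c * (c * f'' (c * r))) (at r within {0..})"
      using c r by (intro DERIV_cmult has_real_derivative_dilate D2) auto
  next
    show "continuous_on {0..} (\<lambda>r. c * (c * f'' (c * r)))"
      using c by (intro continuous_intros continuous_on_compose2[OF cont]) auto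
  qed (simp add: zero)
qed

text \<open>
  The properties of a kernel \<open>v \<mapsto> k(c |v|)\<close> on which the argument for the determinants rests. The factor \<open>c\<close>
  stays inside the norm so that it only changes the line, and analyticity of \<open>k\<close> is used undilated.
\<close>

lemma dilated_radial_kernel:
  fixes k :: "real \<Rightarrow> real" and v u :: "real ^ 'd::finite"
  assumes c: "c > 0" and cont: "continuous_on {0..} k" and lim: "(k \<longlongrightarrow> 0) at_top"
    and an: "\<And>r. r > 0 \<Longrightarrow> extends_holomorphically_at k r"
  shows "(\<lambda>v :: real ^ 'd. k (norm (c *\<^sub>R v))) \<in> borel_measurable borel"
    and "((\<lambda>v :: real ^ 'd. k (norm (c *\<^sub>R v))) \<longlongrightarrow> 0) at_infinity"
    and "v + t *\<^sub>R u \<noteq> 0 \<Longrightarrow> extends_holomorphically_at (\<lambda>s. k (norm (c *\<^sub>R (v + s *\<^sub>R u)))) t"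
proof -
  have "continuous_on UNIV (\<lambda>v :: real ^ 'd. k (norm (c *\<^sub>R v)))"
    by (rule continuous_on_compose2[OF cont]) (auto intro!: continuous_intros)
  then show "(\<lambda>v :: real ^ 'd. k (norm (c *\<^sub>R v))) \<in> borel_measurable borel"
    by (rule borel_measurable_continuous_onI)
  have "filterlim (\<lambda>v :: real ^ 'd. c * norm v) at_top at_infinity"
    by (rule filterlim_tendsto_pos_mult_at_top[OF tendsto_const c filterlim_norm_at_top])
  then have "filterlim (\<lambda>v :: real ^ 'd. norm (c *\<^sub>R v)) at_top at_infinity"
    using c by simp
  from filterlim_compose[OF lim this]
  show "((\<lambda>v :: real ^ 'd. k (norm (c *\<^sub>R v))) \<longlongrightarrow> 0) at_infinity" .
  assume nz: "v + t *\<^sub>R u \<noteq> 0"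
  have eq: "c *\<^sub>R (v + s *\<^sub>R u) = c *\<^sub>R v + s *\<^sub>R (c *\<^sub>R u)" for s
    by (simp add: scaleR_add_right mult.commute)
  have "c *\<^sub>R v + t *\<^sub>R (c *\<^sub>R u) \<noteq> 0"
    unfolding eq[symmetric] using nz c by simp
  then show "extends_holomorphically_at (\<lambda>s. k (norm (c *\<^sub>R (v + s *\<^sub>R u)))) t"
    unfolding eq by (intro extends_holomorphically_at_radial_line an) simp_all
qed

section \<open>Collocation determinants\<close>

lemma invertible_mat_iff_det_nonzero:
  fixes A :: "'a::field mat"
  assumes A: "A \<in> carrier_mat n n"
  shows "invertible_mat A \<longleftrightarrow> det A \<noteq> 0"
proof
  assume "invertible_mat A"
  then obtain B where AB: "A * B = 1\<^sub>m n" and BA: "B * A = 1\<^sub>m (dim_row B)"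
    using A by (auto simp: invertible_mat_def inverts_mat_def)
  have "dim_col B = n" using arg_cong[OF AB, of dim_col] by simp
  moreover have "dim_row B = n" using arg_cong[OF BA, of dim_col] A by simp
  ultimately have B: "B \<in> carrier_mat n n" by auto
  have "det A * det B = 1" using det_mult[OF A B] AB by simp
  then show "det A \<noteq> 0" by auto
next
  assume "det A \<noteq> 0"
  from det_non_zero_imp_unit[OF A this] obtain B where "B \<in> carrier_mat n n" "B * A = 1\<^sub>m n" "A * B = 1\<^sub>m n"
    by (auto simp: Units_def ring_mat_def)
  then show "invertible_mat A"
    using A by (auto simp: invertible_mat_def inverts_mat_def intro!: exI[of _ B])
qed

text \<open>
  Interior points first, then boundary points: with this numbering the block matrix is given by a single
  formula for its entries.
\<close>

definition node :: "nat \<Rightarrow> (nat \<Rightarrow> 'a) \<Rightarrow> (nat \<Rightarrow> 'a) \<Rightarrow> nat \<Rightarrow> 'a" where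
  "node n P Q a = (if a < n then P a else Q (a - n))"

definition collocation_det ::
  "('a::real_normed_vector \<Rightarrow> real) \<Rightarrow> ('a \<Rightarrow> real) \<Rightarrow> nat \<Rightarrow> (nat \<Rightarrow> 'a) \<Rightarrow> nat \<Rightarrow> (nat \<Rightarrow> 'a) \<Rightarrow> real" where
  "collocation_det \<kappa> \<beta> m Q n P =
     det (mat (n + m) (n + m) (\<lambda>(a, b). (if a < n then \<kappa> else \<beta>) (node n P Q a - node n P Q b)))"

lemma collocation_det_expand:
  "collocation_det \<kappa> \<beta> m Q n P =
     (\<Sum>p | p permutes {0..<n + m}. signof p *
        (\<Prod>a = 0..<n + m. (if a < n then \<kappa> else \<beta>) (node n P Q a - node n P Q (p a))))"
  unfolding collocation_det_def
  by (subst det_def'[of _ "n + m"])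
     (auto intro!: sum.cong prod.cong simp: permutes_in_image)

lemma collocation_det_cong:
  assumes "\<And>i. i < n \<Longrightarrow> P i = P' i"
  shows "collocation_det \<kappa> \<beta> m Q n P = collocation_det \<kappa> \<beta> m Q n P'"
proof -
  have "node n P Q = node n P' Q" using assms by (auto simp: node_def fun_eq_iff)
  then show ?thesis by (simp add: collocation_det_def)
qed

lemma det_eq_pivot_times_minor:
  fixes A :: "'a::comm_ring_1 mat"
  assumes A: "A \<in> carrier_mat k k" and i: "i < k"
    and row: "\<And>j. j < k \<Longrightarrow> j \<noteq> i \<Longrightarrow> A $$ (i, j) = 0"
  shows "det A = A $$ (i, i) * det (mat_delete A i i)"
proof -
  have "det A = (\<Sum>j<k. A $$ (i, j) * cofactor A i j)" by (rule laplace_expansion_row[OF A i])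
  also have "\<dots> = (\<Sum>j<k. if j = i then A $$ (i, i) * cofactor A i i else 0)"
    by (intro sum.cong) (auto simp: row)
  also have "\<dots> = A $$ (i, i) * cofactor A i i" using i by simp
  also have "cofactor A i i = det (mat_delete A i i)" by (simp add: cofactor_def)
  finally show ?thesis .
qed

text \<open>
  As the point with index \<open>n\<close> recedes, row and column \<open>n\<close> vanish in the limit except for their common entry,
  which is constantly \<open>\<kappa> 0\<close>. Deleting them leaves the matrix of the remaining nodes.
\<close>

lemma collocation_det_tendsto:
  fixes \<kappa> \<beta> :: "'a::real_normed_vector \<Rightarrow> real"
  assumes k: "(\<kappa> \<longlongrightarrow> 0) at_infinity" and l: "(\<beta> \<longlongrightarrow> 0) at_infinity"
    and x: "filterlim x at_infinity F"
  shows "((\<lambda>s. collocation_det \<kappa> \<beta> m Q (Suc n) (P(n := x s)))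
           \<longlongrightarrow> \<kappa> 0 * collocation_det \<kappa> \<beta> m Q n P) F"
proof -
  define N where "N = Suc n + m"
  define e where "e = (\<lambda>y a b. (if a < Suc n then \<kappa> else \<beta>)
      (node (Suc n) (P(n := y)) Q a - node (Suc n) (P(n := y)) Q b))"
  \<comment> \<open>The limit matrix. The position of the moving point does not enter the entries that are kept, so the placeholder 0 serves.\<close>
  define B where "B = mat N N (\<lambda>(a, b). if (a = n) = (b = n) then e 0 a b else 0)"
  have n: "n < N" by (simp add: N_def)
  have to0: "((\<lambda>s. g (x s - c)) \<longlongrightarrow> 0) F" "((\<lambda>s. g (c - x s)) \<longlongrightarrow> 0) F"
    if "(g \<longlongrightarrow> 0) at_infinity" for g :: "'a \<Rightarrow> real" and c
  proof -
    have "filterlim (\<lambda>s. - c + x s) at_infinity F"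
      by (rule tendsto_add_filterlim_at_infinity[OF tendsto_const x])
    moreover have "filterlim (\<lambda>s. c + - x s) at_infinity F"
      using x by (intro tendsto_add_filterlim_at_infinity[OF tendsto_const])
                 (simp add: filterlim_at_infinity_conv_norm_at_top)
    ultimately show "((\<lambda>s. g (x s - c)) \<longlongrightarrow> 0) F" "((\<lambda>s. g (c - x s)) \<longlongrightarrow> 0) F"
      using filterlim_compose[OF that] by (simp_all add: algebra_simps)
  qed
  have lim: "((\<lambda>s. e (x s) a b) \<longlongrightarrow> B $$ (a, b)) F" if "a < N" "b < N" for a b
  proof (cases "(a = n) = (b = n)")
    case True
    then have "e (x s) a b = B $$ (a, b)" for s
      using that by (auto simp: B_def e_def node_def)
    then show ?thesis by simp
  next
    case False
    then have "B $$ (a, b) = 0" using that by (simp add: B_def)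
    moreover have "((\<lambda>s. e (x s) a b) \<longlongrightarrow> 0) F"
    proof (cases "a = n")
      case True
      then have "e (x s) a b = \<kappa> (x s - node (Suc n) P Q b)" for s
        using False by (simp add: e_def node_def)
      then show ?thesis using to0(1)[OF k] by simp
    next
      case a: False
      then have "e (x s) a b = (if a < Suc n then \<kappa> else \<beta>) (node (Suc n) P Q a - x s)" for s
        using False by (simp add: e_def node_def)
      then show ?thesis using to0(2)[OF k] to0(2)[OF l] by simp
    qed
    ultimately show ?thesis by simp
  qed
  have expand: "collocation_det \<kappa> \<beta> m Q (Suc n) (P(n := y)) =
      (\<Sum>p | p permutes {0..<N}. signof p * (\<Prod>a = 0..<N. e y a (p a)))" for y
    unfolding collocation_det_expand N_def e_def ..
  have "((\<lambda>s. collocation_det \<kappa> \<beta> m Q (Suc n) (P(n := x s)))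
      \<longlongrightarrow> (\<Sum>p | p permutes {0..<N}. signof p * (\<Prod>a = 0..<N. B $$ (a, p a)))) F"
    unfolding expand
    by (intro tendsto_sum tendsto_mult tendsto_const tendsto_prod lim)
       (auto simp: permutes_in_image)
  also have "(\<Sum>p | p permutes {0..<N}. signof p * (\<Prod>a = 0..<N. B $$ (a, p a))) = det B"
    by (rule det_def'[symmetric]) (simp add: B_def)
  also have "det B = B $$ (n, n) * det (mat_delete B n n)"
    by (rule det_eq_pivot_times_minor[OF _ n]) (use n in \<open>auto simp: B_def\<close>)
  also have "B $$ (n, n) = \<kappa> 0" using n by (simp add: B_def e_def)
  also have "det (mat_delete B n n) = collocation_det \<kappa> \<beta> m Q n P"
    unfolding collocation_det_def
    by (rule arg_cong[of _ _ det], rule eq_matI)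
       (auto simp: mat_delete_def B_def N_def e_def node_def Suc_diff_le not_less)
  finally show ?thesis .
qed

section \<open>Generic position of one further point\<close>

text \<open>
  What the argument uses of the two kernels. Analyticity is required only along lines, and only where they
  avoid the origin, the singularity of the norm.
\<close>

locale analytic_kernels =
  fixes \<kappa> \<beta> :: "real ^ 'd::finite \<Rightarrow> real"
  assumes dim: "CARD('d) \<ge> 2"
    and measurable_kernels [measurable]: "\<kappa> \<in> borel_measurable borel" "\<beta> \<in> borel_measurable borel"
    and decay: "(\<kappa> \<longlongrightarrow> 0) at_infinity" "(\<beta> \<longlongrightarrow> 0) at_infinity"
    and pivot: "\<kappa> 0 \<noteq> 0"
    and analytic_lines:
      "\<And>v u t. v + t *\<^sub>R u \<noteq> 0 \<Longrightarrow> extends_holomorphically_at (\<lambda>s. \<kappa> (v + s *\<^sub>R u)) t"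
      "\<And>v u t. v + t *\<^sub>R u \<noteq> 0 \<Longrightarrow> extends_holomorphically_at (\<lambda>s. \<beta> (v + s *\<^sub>R u)) t"
begin

lemma collocation_det_analytic_on_line:
  fixes y u :: "real ^ 'd"
  assumes avoid: "\<And>b. b < Suc n + m \<Longrightarrow> b \<noteq> n \<Longrightarrow> y + t *\<^sub>R u \<noteq> node (Suc n) P Q b"
  shows "extends_holomorphically_at (\<lambda>s. collocation_det \<kappa> \<beta> m Q (Suc n) (P(n := y + s *\<^sub>R u))) t"
proof -
  define e where "e s a b = (if a < Suc n then \<kappa> else \<beta>)
      (node (Suc n) (P(n := y + s *\<^sub>R u)) Q a - node (Suc n) (P(n := y + s *\<^sub>R u)) Q b)" for s a b
  have fixed: "node (Suc n) (P(n := y + s *\<^sub>R u)) Q b = node (Suc n) P Q b" if "b \<noteq> n" for b s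
    using that by (simp add: node_def)
  have moving: "node (Suc n) (P(n := y + s *\<^sub>R u)) Q n = y + s *\<^sub>R u" for s
    by (simp add: node_def)
  have "extends_holomorphically_at (\<lambda>s. e s a b) t" if ab: "a < Suc n + m" "b < Suc n + m" for a b
  proof (cases "a = n"; cases "b = n")
    assume "a = n" "b = n"
    then show ?thesis by (simp add: e_def extends_holomorphically_at_const)
  next
    assume a: "a = n" and b: "b \<noteq> n"
    have "(\<lambda>s. e s a b) = (\<lambda>s. \<kappa> ((y - node (Suc n) P Q b) + s *\<^sub>R u))"
      unfolding e_def a moving fixed[OF b] by (simp add: algebra_simps)
    moreover have "(y - node (Suc n) P Q b) + t *\<^sub>R u \<noteq> 0"
      using avoid[OF ab(2) b] by (simp add: algebra_simps)
    ultimately show ?thesis using analytic_lines(1) by simp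
  next
    assume a: "a \<noteq> n" and b: "b = n"
    have eq: "(\<lambda>s. e s a b) = (\<lambda>s. (if a < Suc n then \<kappa> else \<beta>) ((node (Suc n) P Q a - y) + s *\<^sub>R (- u)))"
      unfolding e_def b moving fixed[OF a] by (simp add: algebra_simps)
    have "(node (Suc n) P Q a - y) + t *\<^sub>R (- u) \<noteq> 0"
      using avoid[OF ab(1) a] by (simp add: algebra_simps)
    from analytic_lines[OF this] show ?thesis
      unfolding eq by (cases "a < Suc n") (simp_all only: if_True if_False)
  next
    assume a: "a \<noteq> n" and b: "b \<noteq> n"
    show ?thesis unfolding e_def fixed[OF a] fixed[OF b] by (rule extends_holomorphically_at_const)
  qed
  then show ?thesis
    unfolding collocation_det_expand e_def[symmetric]
    by (intro extends_holomorphically_at_sum extends_holomorphically_at_mult extends_holomorphically_at_const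
        extends_holomorphically_at_prod) (auto simp: permutes_in_image)
qed

lemma collocation_det_not_zero_on_line:
  fixes y u :: "real ^ 'd"
  assumes "u \<noteq> 0" and prev: "collocation_det \<kappa> \<beta> m Q n P \<noteq> 0"
  shows "\<exists>t. collocation_det \<kappa> \<beta> m Q (Suc n) (P(n := y + t *\<^sub>R u)) \<noteq> 0"
proof -
  have "filterlim (\<lambda>t::real. norm u * \<bar>t\<bar>) at_top at_top"
    using assms(1) by (intro filterlim_tendsto_pos_mult_at_top[OF tendsto_const] filterlim_abs_real) simp_all
  then have "filterlim (\<lambda>t::real. t *\<^sub>R u) at_infinity at_top"
    by (simp add: filterlim_at_infinity_conv_norm_at_top mult.commute)
  then have "filterlim (\<lambda>t. y + t *\<^sub>R u) at_infinity at_top"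
    by (rule tendsto_add_filterlim_at_infinity[OF tendsto_const])
  from collocation_det_tendsto[OF decay this, of m Q n P]
  have "\<forall>\<^sub>F t in at_top. collocation_det \<kappa> \<beta> m Q (Suc n) (P(n := y + t *\<^sub>R u)) \<noteq> 0"
    by (rule tendsto_imp_eventually_ne) (use pivot prev in simp)
  then show ?thesis
    using eventually_happens'[OF trivial_limit_at_top_linorder] by blast
qed

text \<open>
  Lines parallel to the axis \<open>i\<close> keep the coordinate \<open>j\<close> constant. They avoid every node once this coordinate
  differs from that of every node, which excludes finitely many hyperplanes only. This is where dimension at
  least two enters: on the real line the moving point would have to cross the other nodes.
\<close>

lemma singular_positions_null:
  assumes prev: "collocation_det \<kappa> \<beta> m Q n P \<noteq> 0"
  shows "{y. collocation_det \<kappa> \<beta> m Q (Suc n) (P(n := y)) = 0} \<in> null_sets lborel" (is "?Z \<in> _")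
proof -
  obtain i j :: 'd where ij: "i \<noteq> j"
    using dim by (metis card_2_iff' card_le_Suc0_iff_eq finite UNIV_I not_less_eq_eq numeral_2_eq_2)
  define u :: "real ^ 'd" where "u = axis i 1"
  have "u $ i = 1" and "u $ j = 0"
    using ij by (simp_all add: u_def axis_def)
  then have u: "u \<noteq> 0" "u $ j = 0" by auto
  have node: "(\<lambda>y. node (Suc n) (P(n := y)) Q a) \<in> borel_measurable borel" for a
    by (cases "a = n"; cases "a < Suc n") (simp_all add: node_def)
  have [measurable]: "(\<lambda>y. (if a < Suc n then \<kappa> else \<beta>)
      (node (Suc n) (P(n := y)) Q a - node (Suc n) (P(n := y)) Q b)) \<in> borel_measurable borel" for a b
    using node by (cases "a < Suc n") simp_all
  have "?Z \<in> sets borel"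
    unfolding collocation_det_expand by measurable
  \<comment> \<open>The range includes b = n, the former position of the moving point; that excludes one further null set.\<close>
  moreover have "AE y in (lborel :: (real ^ 'd) measure). \<forall>b\<in>{..<Suc n + m}. y \<bullet> axis j 1 \<noteq> node (Suc n) P Q b $ j"
    by (intro AE_finite_allI AE_lborel_inner_neq) (auto simp: Basis_real_def)
  then have "AE y in lborel. countable {t. y + t *\<^sub>R u \<in> ?Z}"
  proof eventually_elim
    case (elim y)
    have "y + t *\<^sub>R u \<noteq> node (Suc n) P Q b" if "b < Suc n + m" for b t
    proof
      assume "y + t *\<^sub>R u = node (Suc n) P Q b"
      then have "(y + t *\<^sub>R u) $ j = node (Suc n) P Q b $ j" by simp
      then show False using bspec[OF elim, of b] that u(2) by (simp add: inner_axis)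
    qed
    then have "extends_holomorphically_at (\<lambda>s. collocation_det \<kappa> \<beta> m Q (Suc n) (P(n := y + s *\<^sub>R u))) t" for t
      by (intro collocation_det_analytic_on_line) auto
    moreover obtain t where "collocation_det \<kappa> \<beta> m Q (Suc n) (P(n := y + t *\<^sub>R u)) \<noteq> 0"
      using collocation_det_not_zero_on_line[OF u(1) prev] by blast
    ultimately show ?case using countable_zeros_if_analytic by simp
  qed
  ultimately show ?thesis by (rule null_set_if_countable_along_lines)
qed

text \<open>
  Integrating out the last point first: for almost all positions of the earlier points the determinant of
  these is nonzero by induction, and then the bad positions of the last point are negligible for its law.
\<close>

lemma AE_product_collocation_det_nonzero:
  fixes \<mu> :: "nat \<Rightarrow> (real ^ 'd) measure"
  assumes prob: "\<And>i. prob_space (\<mu> i)" and sets: "\<And>i. sets (\<mu> i) = sets borel"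
    and ac: "\<And>i. absolutely_continuous lborel (\<mu> i)"
    and base: "collocation_det \<kappa> \<beta> m Q 0 P\<^sub>0 \<noteq> 0"
  shows "AE p in PiM {..<n} \<mu>. collocation_det \<kappa> \<beta> m Q n p \<noteq> 0"
proof (induction n)
  case 0
  have "collocation_det \<kappa> \<beta> m Q 0 p \<noteq> 0" for p
    using base collocation_det_cong[of 0 p P\<^sub>0] by simp
  then show ?case by simp
next
  case (Suc n)
  interpret product_sigma_finite \<mu>
    by (rule product_sigma_finite.intro) (rule prob_space_imp_sigma_finite[OF prob])
  let ?B = "\<lambda>p. collocation_det \<kappa> \<beta> m Q (Suc n) p"
  have node: "(\<lambda>p. node (Suc n) p Q a) \<in> borel_measurable (PiM {..<Suc n} \<mu>)" for a
  proof (cases "a < Suc n")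
    case True
    then have "(\<lambda>p. p a) \<in> measurable (PiM {..<Suc n} \<mu>) (\<mu> a)"
      by (intro measurable_component_singleton) simp
    then show ?thesis using True by (simp add: node_def measurable_cong_sets[OF refl sets])
  qed (simp add: node_def)
  have [measurable]: "(\<lambda>p. (if a < Suc n then \<kappa> else \<beta>) (node (Suc n) p Q a - node (Suc n) p Q b))
      \<in> borel_measurable (PiM {..<Suc n} \<mu>)" for a b
    using node by (cases "a < Suc n") simp_all
  have [measurable]: "?B \<in> borel_measurable (PiM {..<Suc n} \<mu>)"
    unfolding collocation_det_expand by measurable
  \<comment> \<open>The integral of this indicator is the probability of a singular configuration.\<close>
  let ?f = "\<lambda>p. indicator {0::real} (?B p) :: ennreal"
  have "(\<integral>\<^sup>+p. ?f p \<partial>PiM {..<Suc n} \<mu>) = (\<integral>\<^sup>+p. (\<integral>\<^sup>+y. ?f (p(n := y)) \<partial>\<mu> n) \<partial>PiM {..<n} \<mu>)"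
    unfolding lessThan_Suc
    by (rule product_nn_integral_insert) (simp_all flip: lessThan_Suc)
  also have "\<dots> = (\<integral>\<^sup>+p. 0 \<partial>PiM {..<n} \<mu>)"
  proof (rule nn_integral_cong_AE, use Suc in eventually_elim)
    case (elim p)
    have "{y. ?B (p(n := y)) = 0} \<in> null_sets (\<mu> n)"
      using singular_positions_null[OF elim] ac[of n] by (auto simp: absolutely_continuous_def)
    then have "AE y in \<mu> n. y \<notin> {y. ?B (p(n := y)) = 0}" by (rule AE_not_in)
    then have "AE y in \<mu> n. ?f (p(n := y)) = 0" by eventually_elim simp
    then have "(\<integral>\<^sup>+y. ?f (p(n := y)) \<partial>\<mu> n) = (\<integral>\<^sup>+y. 0 \<partial>\<mu> n)" by (rule nn_integral_cong_AE)
    then show ?case by simp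
  qed
  finally have "(\<integral>\<^sup>+p. ?f p \<partial>PiM {..<Suc n} \<mu>) = 0" by simp
  then have "AE p in PiM {..<Suc n} \<mu>. ?f p = 0"
    by (subst (asm) nn_integral_0_iff_AE) simp_all
  then show ?case by eventually_elim (simp add: indicator_def split: if_splits)
qed

end

section \<open>Independent random points\<close>

lemma absolutely_continuous_if_has_density_on:
  fixes X :: "'w \<Rightarrow> real ^ 'd::finite"
  assumes "has_density_on M X \<Omega> \<sigma>"
  shows "absolutely_continuous lborel (distr M borel X)"
  unfolding absolutely_continuous_def
proof
  fix N assume N: "N \<in> null_sets (lborel :: (real ^ 'd) measure)"
  have X[measurable]: "X \<in> borel_measurable M" and Nb: "N \<in> sets borel"
    using assms N by (auto simp: has_density_on_def)
  have "N \<in> null_sets lebesgue" using N by (rule null_sets_completionI)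
  from AE_not_in[OF this]
  have "AE x in lebesgue. ennreal (\<sigma> x) * indicator (N \<inter> \<Omega>) x = 0"
    by eventually_elim simp
  then have "(\<integral>\<^sup>+x\<in>N \<inter> \<Omega>. ennreal (\<sigma> x) \<partial>lebesgue) = (\<integral>\<^sup>+x. 0 \<partial>(lebesgue :: (real ^ 'd) measure))"
    by (rule nn_integral_cong_AE)
  then have "emeasure (distr M borel X) N = 0"
    using assms Nb by (simp add: has_density_on_def emeasure_distr)
  then show "N \<in> null_sets (distr M borel X)" using Nb by (auto simp: null_sets_def)
qed

text \<open>
  The joint law of independent variables is the product of their laws. Statements about a generic
  configuration can therefore be proved by successive integration.
\<close>

lemma AE_independent_if_AE_product:
  fixes X :: "'i \<Rightarrow> 'w \<Rightarrow> 'a"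
  assumes M: "prob_space M" and indep: "prob_space.indep_vars M (\<lambda>_. N) X UNIV" and ne: "I \<noteq> {}"
    and AE: "AE p in PiM I (\<lambda>i. distr M N (X i)). A p"
  shows "AE \<omega> in M. A (\<lambda>i\<in>I. X i \<omega>)"
proof -
  interpret prob_space M by fact
  have rv: "random_variable N (X i)" for i
    using indep by (auto simp: indep_vars_def)
  have "indep_vars (\<lambda>_. N) X I" using indep by (rule indep_vars_subset) simp
  then have eq: "distr M (PiM I (\<lambda>_. N)) (\<lambda>\<omega>. \<lambda>i\<in>I. X i \<omega>) = PiM I (\<lambda>i. distr M N (X i))"
    using ne rv by (subst (asm) indep_vars_iff_distr_eq_PiM) auto
  have "AE p in distr M (PiM I (\<lambda>_. N)) (\<lambda>\<omega>. \<lambda>i\<in>I. X i \<omega>). A p"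
    unfolding eq by (rule AE)
  then show ?thesis
    by (rule AE_distrD[rotated]) (intro measurable_restrict rv)
qed

section \<open>The Kansa matrix\<close>

lemma kansa_matrix_eq_collocation:
  assumes "\<And>c x. laplacian (radial_at \<psi> c) x = \<kappa> (x - c)" and "\<And>c x. radial_at \<psi> c x = \<beta> (x - c)"
  shows "kansa_matrix \<psi> n m P Q =
    mat (n + m) (n + m) (\<lambda>(a, b). (if a < n then \<kappa> else \<beta>) (node n P Q a - node n P Q b))"
  by (rule eq_matI) (auto simp: kansa_matrix_def assms node_def)

theorem theorem1:
  fixes \<Omega> :: "(real ^ 'd::finite) set"
    and \<epsilon> :: real
    and \<phi> :: "real \<Rightarrow> real"
    and m n :: nat
    and Q :: "nat \<Rightarrow> real ^ 'd"
    and M :: "'w measure"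
    and P :: "nat \<Rightarrow> 'w \<Rightarrow> real ^ 'd"
    and \<sigma> :: "real ^ 'd \<Rightarrow> real"
  assumes dim: "CARD('d) \<ge> 2"
    and domain: "open \<Omega>" "connected \<Omega>" "\<Omega> \<noteq> {}" "bounded \<Omega>"
    and eps: "\<epsilon> > 0"
    and smooth: "C2_on \<phi> {0..}"
    and analytic: "real_analytic_on \<phi> {0<..}"
    and phi_lim: "(\<phi> \<longlongrightarrow> 0) at_top"
    and ell_zero: "\<exists>l. (ell \<phi> \<longlongrightarrow> l) (at_right 0) \<and> l \<noteq> 0"
    and ell_lim: "(ell \<phi> \<longlongrightarrow> 0) at_top"
    and interp: "\<And>(k::nat) (X :: nat \<Rightarrow> real ^ 'd). k \<ge> 1 \<Longrightarrow> inj_on X {..<k} \<Longrightarrow>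
                   invertible_mat (interp_matrix (scaled \<epsilon> \<phi>) k X)"
    and m: "m \<ge> 1"
    and Q: "inj_on Q {..<m}" "Q ` {..<m} \<subseteq> frontier \<Omega>"
    and prob: "prob_space M"
    and density: "prob_density_on \<Omega> \<sigma>"
    and law: "\<And>i. has_density_on M (P i) \<Omega> \<sigma>"
    and indep: "prob_space.indep_vars M (\<lambda>_. borel) P UNIV"
  shows "AE \<omega> in M. invertible_mat (kansa_matrix (scaled \<epsilon> \<phi>) n m (\<lambda>i. P i \<omega>) Q)"
proof -
  obtain f' f'' where prof: "radial_profile \<phi> f' f''" and f''0: "f'' 0 \<noteq> 0"
    and ell: "\<And>r. r > 0 \<Longrightarrow> ell \<phi> r = f'' r + f' r / r"
    by (rule C2_radial_profile_if_ell_nonzero[OF smooth ell_zero]) blast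
  interpret radial_profile \<phi> f' f'' by (rule prof)
  \<comment> \<open>Dilating the argument by the shape parameter multiplies second derivatives by its square.\<close>
  define k where "k r = \<epsilon>\<^sup>2 * radial_laplacian CARD('d) f' f'' r" for r
  define \<kappa> where "\<kappa> v = k (norm (\<epsilon> *\<^sub>R v))" for v :: "real ^ 'd"
  define \<beta> where "\<beta> v = \<phi> (norm (\<epsilon> *\<^sub>R v))" for v :: "real ^ 'd"

  have phi_cont: "continuous_on {0..} \<phi>"
    using D1 by (intro DERIV_continuous_on) auto
  have phi_an: "extends_holomorphically_at \<phi> r" if "r > 0" for r
    using analytic that extends_holomorphically_at_if_fps_expansion unfolding real_analytic_on_def by blast
  have \<beta>: "\<beta> \<in> borel_measurable borel" "(\<beta> \<longlongrightarrow> 0) at_infinity"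
    "\<And>v u t. v + t *\<^sub>R u \<noteq> 0 \<Longrightarrow> extends_holomorphically_at (\<lambda>s. \<beta> (v + s *\<^sub>R u)) t"
    unfolding \<beta>_def[abs_def] by (rule dilated_radial_kernel[OF eps phi_cont phi_lim phi_an]; assumption)+

  have k_cont: "continuous_on {0..} k"
    unfolding k_def[abs_def] using dim
    by (intro continuous_intros radial_laplacian_continuous) auto
  have k_lim: "(k \<longlongrightarrow> 0) at_top"
  proof -
    have "((\<lambda>r. f'' r + f' r / r) \<longlongrightarrow> 0) at_top"
      by (rule Lim_transform_eventually[OF ell_lim])
         (rule eventually_mono[OF eventually_gt_at_top[of 0]], simp add: ell)
    then show ?thesis
      unfolding k_def[abs_def]
      by (intro tendsto_mult_right_zero radial_laplacian_tendsto_0)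
  qed
  have k_an: "extends_holomorphically_at k r" if "r > 0" for r
    unfolding k_def[abs_def]
    by (intro extends_holomorphically_at_mult extends_holomorphically_at_const
        radial_laplacian_analytic[OF analytic that])
  have \<kappa>: "\<kappa> \<in> borel_measurable borel" "(\<kappa> \<longlongrightarrow> 0) at_infinity"
    "\<And>v u t. v + t *\<^sub>R u \<noteq> 0 \<Longrightarrow> extends_holomorphically_at (\<lambda>s. \<kappa> (v + s *\<^sub>R u)) t"
    unfolding \<kappa>_def[abs_def] by (rule dilated_radial_kernel[OF eps k_cont k_lim k_an]; assumption)+

  have "\<kappa> 0 \<noteq> 0"
    using f''0 eps by (simp add: \<kappa>_def k_def radial_laplacian_def)
  then interpret analytic_kernels \<kappa> \<beta>
    using dim \<kappa> \<beta> by unfold_locales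

  have lap: "laplacian (radial_at (scaled \<epsilon> \<phi>) c) x = \<kappa> (x - c)" for c x :: "real ^ 'd"
  proof -
    have "laplacian (radial_at (scaled \<epsilon> \<phi>) c) x
        = radial_laplacian CARD('d) (\<lambda>r. \<epsilon> * f' (\<epsilon> * r)) (\<lambda>r. \<epsilon> * (\<epsilon> * f'' (\<epsilon> * r))) (norm (x - c))"
      by (rule radial_profile.laplacian_radial[OF radial_profile_scaled[OF eps prof]])
    also have "\<dots> = k (\<epsilon> * norm (x - c))"
      using eps by (auto simp: k_def radial_laplacian_def power2_eq_square distrib_left)
    also have "\<dots> = \<kappa> (x - c)"
      using eps by (simp add: \<kappa>_def)
    finally show ?thesis .
  qed
  have bdry: "radial_at (scaled \<epsilon> \<phi>) c x = \<beta> (x - c)" for c x :: "real ^ 'd"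
    using eps by (simp add: radial_at_def scaled_def \<beta>_def)
  have invertible_iff: "invertible_mat (kansa_matrix (scaled \<epsilon> \<phi>) n m p Q) \<longleftrightarrow> collocation_det \<kappa> \<beta> m Q n p \<noteq> 0"
    for n p
    unfolding kansa_matrix_eq_collocation[OF lap bdry] collocation_det_def
    by (rule invertible_mat_iff_det_nonzero[where n = "n + m"]) simp

  \<comment> \<open>Without interior points only the boundary block is left.\<close>
  have "kansa_matrix (scaled \<epsilon> \<phi>) 0 m p Q = interp_matrix (scaled \<epsilon> \<phi>) m Q" for p
    by (rule eq_matI) (auto simp: kansa_matrix_def interp_matrix_def radial_at_def)
  then have base: "collocation_det \<kappa> \<beta> m Q 0 p \<noteq> 0" for p
    using interp[OF m Q(1)] invertible_iff[of 0 p] by simp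

  have X: "P i \<in> borel_measurable M" for i
    using law[of i] by (simp add: has_density_on_def)
  have AE: "AE p in PiM {..<n} (\<lambda>i. distr M borel (P i)). collocation_det \<kappa> \<beta> m Q n p \<noteq> 0"
    by (rule AE_product_collocation_det_nonzero[OF _ _ absolutely_continuous_if_has_density_on[OF law] base])
       (simp_all add: prob_space.prob_space_distr[OF prob X])
  have "AE \<omega> in M. collocation_det \<kappa> \<beta> m Q n (\<lambda>i. P i \<omega>) \<noteq> 0"
  proof (cases "n = 0")
    case True
    then show ?thesis using base by simp
  next
    case False
    then have "{..<n} \<noteq> {}" by auto
    from AE_independent_if_AE_product[OF prob indep this AE]
    show ?thesis
    proof eventually_elim
      case (elim \<omega>)
      moreover have "collocation_det \<kappa> \<beta> m Q n (\<lambda>i\<in>{..<n}. P i \<omega>) = collocation_det \<kappa> \<beta> m Q n (\<lambda>i. P i \<omega>)"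
        by (rule collocation_det_cong) simp
      ultimately show ?case by simp
    qed
  qed
  then show ?thesis unfolding invertible_iff .
qed

end
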